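(* Consider the learning dynamics on $\mathbb{R}^d$ described in the context, with parameters $\eta>0$, $\beta\in(0,1)$, $\epsilon>0$. Suppose the following hold. (1) (Bounded sensitivity) There is $G>0$ with $\|g_t\|\le G$ for all $t\ge 0$. (2) (Sector-bounded scalar feedback) There are a function $\phi:\mathbb{R}\to\mathbb{R}$ and constants $m,M>0$ such that $s_t=\phi(\tilde r_t)$ for all $t\ge 0$, and $m z^2\le z\phi(z)\le M z^2$ and $|\phi(z)|\le M|z|$ for all $z\in\mathbb{R}$. (3) (Bounded residual mismatch) $\tilde r_t=\chi_t+\delta_t$ with $|\delta_t|\le\overline{\delta}<\infty$ for all $t\ge 0$. (4) (Windowed observability in the update geometry) There are an integer $T\ge 1$ and $\mu>0$ such that for all $t\ge T-1$, $$\sum_{k=0}^{T-1}\psi_{t-k}\psi_{t-k}^{\mathsf T}\succeq \mu I .$$ Put $\underline b:=\epsilon$ and suppose $$0<\eta<\min\left\{\frac{m\underline b^2}{2M^2G^2},\ \frac{\mu m\underline b^4}{4G^4M^2T^2},\ \frac{8}{m\mu}\right\}.$$ Then there exist constants $q\in(0,1)$ and $A,L>0$ such that for all $t\ge 0$, $$\|e_t\|\le A\,q^{\lfloor t/T\rfloor}\,\|e_0\|+L\,\overline{\delta}.$$ One explicit admissible choice is as follows. With $$\alpha_0=\frac{\eta m}{2},\quad \gamma_0=\frac{\eta M^2}{m},\quad \alpha=\frac{\eta m}{4},\quad \gamma=\alpha_0+\gamma_0,\quad \theta=\frac{\mu}{2}-\frac{2\eta G^4M^2T^2}{m\underline b^4},\quad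 \zeta=\frac{2\eta^2G^4M^4T^3}{m^2\underline b^4},$$ take $$q=\sqrt{1-\alpha\theta},\qquad A=1+\eta\frac{GM}{\underline b}\sqrt{\frac{T}{\alpha_0}},\qquad L=A\sqrt{\frac{\alpha\zeta+\gamma T}{\alpha\theta}}+\eta\frac{GM}{\underline b}\,T\sqrt{\frac{\gamma_0}{\alpha_0}} .$$ Alternatively, hypothesis (4) may be replaced by the following, which ensures it: there are an integer $T\ge1$ and $\lambda_g>0$ with $\sum_{k=0}^{T-1}g_{t-k}g_{t-k}^{\mathsf T}\succeq\lambda_g I$ for all $t\ge T-1$, and, with $\overline b:=\epsilon+G^2$ and $$\nu_T:=\sup_{t\ge T-1}\Big(\sum_{k=0}^{T-1}\|B_{t-k}^{-1}-B_t^{-1}\|^2\Big)^{1/2},$$ one has $G\nu_T<\sqrt{\lambda_g}/\overline b$; in this case (4) holds with $\mu=\big(\sqrt{\lambda_g}/\overline b-G\nu_T\big)^2>0$.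
   Context: Setting. Time is $t=0,1,2,\dots$. A scalar-output model $\hat y_t=f(w_t,\tilde x_t)$, differentiable in the parameter $w\in\mathbb{R}^d$, is trained on a stream of (possibly masked) inputs $\tilde x_t$ and targets $y_t\in\mathbb{R}$ with scalar losses $\ell_t(\hat y,y)$ differentiable in $\hat y$. Fix $\eta>0$, $\beta\in(0,1)$, $\epsilon>0$. Define: - the sensitivity $g_t:=\nabla_w f(w_t,\tilde x_t)\in\mathbb{R}^d$; - the scalar feedback $s_t:=\partial\ell_t(\hat y_t,y_t)/\partial\hat y_t$, so that $\nabla_w\ell_t=s_t g_t$; - $S_{-1}=0$, $S_t=\beta S_{t-1}+(1-\beta)g_tg_t^{\mathsf T}$, $B_t=S_t+\epsilon I$; - the update $w_{t+1}=w_t-\eta B_t^{-1}\nabla_w\ell_t=w_t-\eta B_t^{-1}g_ts_t$, with $w_0\in\mathbb{R}^d$ given; - a fixed reference parameter $w^*\in\mathbb{R}^d$ and the error $e_t:=w_t-w^*$, so that $e_{t+1}=e_t-\eta B_t^{-1}g_ts_t$; - the residual $\tilde r_t:=\hat y_t-y_t$; - the effective direction $\psi_t:=B_t^{-1}g_t$ and the signal $\chi_t:=\psi_t^{\mathsf T}e_t$; - the mismatch $\delta_t:=\tilde r_t-\chi_t$. $\|\cdot\|$ is the Euclidean norm on vectors and the induced (spectral) norm on matrices; $\succeq$ is the Loewner order on symmetric matrices. *)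

theory Defs
  imports "HOL-Analysis.Analysis"
begin

text \<open>
  The unique gradient whenever \<open>h\<close> is differentiable at \<open>v\<close>; unspecified otherwise.
\<close>
definition gradient :: "('a::real_inner \<Rightarrow> real) \<Rightarrow> 'a \<Rightarrow> 'a" where
  "gradient h v = (THE D. GDERIV h v :> D)"

definition outer :: "real^'n \<Rightarrow> real^'n \<Rightarrow> real^'n^'n" where
  "outer u v = (\<chi> i j. u $ i * v $ j)"

definition loewner_le :: "real^'n^'n \<Rightarrow> real^'n^'n \<Rightarrow> bool" (infix "\<preceq>\<^sub>L" 50) where
  "A \<preceq>\<^sub>L B \<longleftrightarrow> transpose A = A \<and> transpose B = B \<and>
     (\<forall>v. v \<bullet> (A *v v) \<le> v \<bullet> (B *v v))"

text \<open>
  The library's \<open>norm\<close> on \<open>real^'n^'n\<close> is the Frobenius norm, so the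
  matrix norm induced by the Euclidean norm is taken from \<open>onorm\<close>.
\<close>
definition spectral_norm :: "real^'n^'m \<Rightarrow> real" where
  "spectral_norm A = onorm (\<lambda>v. A *v v)"

text \<open>
  For \<open>k < T\<close> and \<open>T - 1 \<le> t\<close> the natural-number subtraction \<open>t - k\<close>
  does not truncate, here and in \<open>inverse_variation\<close>.
\<close>
definition windowed_lower_bound :: "(nat \<Rightarrow> real^'n) \<Rightarrow> nat \<Rightarrow> real \<Rightarrow> bool" where
  "windowed_lower_bound u T c \<longleftrightarrow>
     (\<forall>t\<ge>T-1. c *\<^sub>R mat 1 \<preceq>\<^sub>L (\<Sum>k<T. outer (u (t-k)) (u (t-k))))"

definition inverse_variation :: "(nat \<Rightarrow> real^'n^'n) \<Rightarrow> nat \<Rightarrow> real" where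
  "inverse_variation B T =
     (SUP t\<in>{T-1..}. sqrt (\<Sum>k<T. (spectral_norm (matrix_inv (B (t-k)) - matrix_inv (B t)))\<^sup>2))"

end

theory Submission
  imports Defs
begin

text \<open>
  The chain rule turns the update into \<open>e (t+1) = e t - \<eta> s t \<psi> t\<close>. The sector condition
  makes each step decrease \<open>\<parallel>e\<parallel>\<^sup>2\<close> by a multiple of the squared residual, up to a term in
  \<open>\<delta>bar\<^sup>2\<close>. Summed over a window of length \<open>T\<close>, the residuals control both the signals
  \<open>\<psi> t \<bullet> e t\<close> and the drift of \<open>e\<close> inside the window, so observability yields a contraction
  of \<open>\<parallel>e\<parallel>\<^sup>2\<close> from window to window; inside a window the drift bound applies again.
\<close>

section \<open>Gradients and the chain rule\<close>

lemma GDERIV_unique: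
  assumes "GDERIV h v :> D" "GDERIV h v :> D'"
  shows "D = D'"
proof -
  have "(\<lambda>x. x \<bullet> D) = (\<lambda>x. x \<bullet> D')"
    using has_derivative_unique[OF assms[unfolded gderiv_def]] .
  then have "\<forall>x. x \<bullet> D = x \<bullet> D'"
    by (simp add: fun_eq_iff)
  then show ?thesis
    by (simp only: vector_eq_ldot)
qed

lemma gradient_eqI: "GDERIV h v :> D \<Longrightarrow> gradient h v = D"
  unfolding gradient_def by (rule the_equality) (auto intro: GDERIV_unique)

text \<open>\<open>gradient\<close> is a definite description, so a witness is needed: the
  derivative \<open>F\<close> is the inner product with \<open>adjoint F 1\<close>, its Riesz
  representative.\<close>

lemma GDERIV_gradient:
  fixes h :: "'a::euclidean_space \<Rightarrow> real"
  assumes "h differentiable (at v)"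
  shows "GDERIV h v :> gradient h v"
proof -
  obtain F where F: "(h has_derivative F) (at v)"
    using assms by (auto simp: differentiable_def)
  have "F = (\<lambda>x. x \<bullet> adjoint F 1)"
    using adjoint_works[OF has_derivative_linear[OF F], of _ 1] by auto
  then have "GDERIV h v :> adjoint F 1"
    using F unfolding gderiv_def by simp
  then show ?thesis
    using gradient_eqI by metis
qed

text \<open>Serves to factor the loss gradient in the update into scalar feedback times
  sensitivity.\<close>

lemma gradient_compose:
  fixes h :: "'a::euclidean_space \<Rightarrow> real"
  assumes "h differentiable (at v)" "l differentiable (at (h v))"
  shows "gradient (\<lambda>v. l (h v)) v = deriv l (h v) *\<^sub>R gradient h v"
  using assms
  by (intro gradient_eqI GDERIV_DERIV_compose GDERIV_gradient)
    (auto simp: DERIV_deriv_iff_real_differentiable)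

section \<open>Outer products, quadratic forms and observability windows\<close>

lemma outer_mult_vector: "outer u v *v x = (v \<bullet> x) *\<^sub>R u"
  by (simp add: outer_def matrix_vector_mult_def inner_vec_def vec_eq_iff sum_distrib_left mult_ac)

lemma transpose_outer: "transpose (outer u u) = outer u u"
  by (simp add: outer_def transpose_def vec_eq_iff mult.commute)

lemma symmetric_inner:
  fixes A :: "real^'n^'n"
  assumes "transpose A = A"
  shows "(A *v u) \<bullet> v = u \<bullet> (A *v v)"
  by (metis assms dot_lmul_matrix transpose_matrix_vector)

lemma matrix_sum_mult_vector:
  fixes A :: "'a \<Rightarrow> real^'n^'m"
  shows "(\<Sum>k\<in>I. A k) *v x = (\<Sum>k\<in>I. A k *v x)"
  by (induction I rule: infinite_finite_induct) (auto simp: matrix_vector_mult_add_rdistrib)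

lemma transpose_sum:
  fixes A :: "'a \<Rightarrow> real^'n^'m"
  shows "transpose (\<Sum>k\<in>I. A k) = (\<Sum>k\<in>I. transpose (A k))"
  by (simp add: transpose_def vec_eq_iff)

lemma inner_sum_outer:
  "v \<bullet> ((\<Sum>k\<in>I. outer (u k) (u k)) *v v) = (\<Sum>k\<in>I. (u k \<bullet> v)\<^sup>2)"
  by (simp add: matrix_sum_mult_vector outer_mult_vector inner_sum_right power2_eq_square inner_commute)

text \<open>Both sides of the Loewner inequality are symmetric whatever \<open>u\<close> is, so only
  the comparison of quadratic forms remains, and the form of a sum of outer products is a sum of
  squares.\<close>

lemma windowed_lower_bound_iff:
  fixes u :: "nat \<Rightarrow> real^'n"
  shows "windowed_lower_bound u T c \<longleftrightarrow>
    (\<forall>t\<ge>T-1. \<forall>v. c * (norm v)\<^sup>2 \<le> (\<Sum>k<T. (u (t-k) \<bullet> v)\<^sup>2))"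
proof -
  have "transpose (c *\<^sub>R mat 1 :: real^'n^'n) = c *\<^sub>R mat 1"
    by (simp add: transpose_scalar)
  moreover have "transpose (\<Sum>k<T. outer (u (t-k)) (u (t-k))) = (\<Sum>k<T. outer (u (t-k)) (u (t-k)))" for t
    by (simp add: transpose_sum transpose_outer)
  moreover have "v \<bullet> ((c *\<^sub>R mat 1) *v v) = c * (norm v)\<^sup>2" for v :: "real^'n"
    by (simp add: scaleR_matrix_vector_assoc[symmetric] power2_norm_eq_inner)
  ultimately show ?thesis
    unfolding windowed_lower_bound_def loewner_le_def inner_sum_outer by simp
qed

text \<open>Windows in the definition run backwards from their last index, whereas the energy
  argument runs forwards from \<open>a\<close>. The last index is \<open>a + T - 1\<close>, and
  reversing the order of summation matches the two.\<close>

lemma windowed_lower_boundD: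
  assumes "windowed_lower_bound u T c" "T \<ge> 1"
  shows "c * (norm v)\<^sup>2 \<le> (\<Sum>k<T. (u (a + k) \<bullet> v)\<^sup>2)"
proof -
  have "T - 1 \<le> a + T - 1" by simp
  then have "c * (norm v)\<^sup>2 \<le> (\<Sum>k<T. (u (a + T - 1 - k) \<bullet> v)\<^sup>2)"
    using assms(1) unfolding windowed_lower_bound_iff by blast
  also have "\<dots> = (\<Sum>k<T. (u (a + (T - Suc k)) \<bullet> v)\<^sup>2)"
    by (intro sum.cong) auto
  also have "\<dots> = (\<Sum>k<T. (u (a + k) \<bullet> v)\<^sup>2)"
    by (rule sum.nat_diff_reindex)
  finally show ?thesis .
qed

text \<open>The weights of the moving average add up to at most one, hence the bound by \<open>G\<^sup>2\<close>.\<close>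
lemma moving_average_bounds:
  fixes g :: "nat \<Rightarrow> real^'n"
  assumes S: "\<And>t. S t = \<beta> *\<^sub>R (if t = 0 then 0 else S (t-1)) + (1 - \<beta>) *\<^sub>R outer (g t) (g t)"
    and \<beta>: "0 \<le> \<beta>" "\<beta> \<le> 1"
    and g: "\<And>t. norm (g t) \<le> G"
  shows "transpose (S t) = S t" "0 \<le> v \<bullet> (S t *v v)" "norm (S t *v v) \<le> G\<^sup>2 * norm v"
proof -
  have scale: "(a *\<^sub>R X + b *\<^sub>R Y) *v x = a *\<^sub>R (X *v x) + b *\<^sub>R (Y *v x)"
    for a b and X Y :: "real^'n^'n" and x
    by (simp add: matrix_vector_mult_add_rdistrib scaleR_matrix_vector_assoc)
  have tr: "transpose (a *\<^sub>R X + b *\<^sub>R Y) = a *\<^sub>R transpose X + b *\<^sub>R transpose Y"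
    for a b and X Y :: "real^'n^'n"
    by (simp add: transpose_def vec_eq_iff)
  have o: "norm (outer (g t) (g t) *v v) \<le> G\<^sup>2 * norm v" for t v
  proof -
    have "norm (outer (g t) (g t) *v v) \<le> (norm (g t) * norm v) * norm (g t)"
      by (simp add: outer_mult_vector mult_right_mono Cauchy_Schwarz_ineq2)
    also have "\<dots> = (norm (g t))\<^sup>2 * norm v" by (simp add: power2_eq_square)
    also have "\<dots> \<le> G\<^sup>2 * norm v" using g by (intro mult_right_mono power_mono) auto
    finally show ?thesis .
  qed
  have conv: "norm (\<beta> *\<^sub>R x + (1 - \<beta>) *\<^sub>R y) \<le> c"
    if "norm x \<le> c" "norm y \<le> c" for x y :: "real^'n" and c
    using convexD[OF convex_cball[of 0 c], of x y \<beta> "1 - \<beta>"] that \<beta> by simp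
  \<comment> \<open>The three properties are bundled so that a single induction carries them
    all.\<close>
  define P :: "real^'n^'n \<Rightarrow> bool" where
    "P X \<longleftrightarrow> transpose X = X \<and> (\<forall>v. 0 \<le> v \<bullet> (X *v v) \<and> norm (X *v v) \<le> G\<^sup>2 * norm v)" for X
  have step: "P (\<beta> *\<^sub>R X + (1 - \<beta>) *\<^sub>R outer (g t) (g t))" if "P X" for X t
  proof -
    have "0 \<le> v \<bullet> (outer (g t) (g t) *v v)" for v
      by (simp add: outer_mult_vector inner_commute)
    then show ?thesis
      using that \<beta> conv[OF _ o] unfolding P_def by (simp add: scale tr transpose_outer inner_add_right)
  qed
  have "P (S t)"
  proof (induction t)
    case 0
    \<comment> \<open>The zero matrix stands for the average before time 0, so the base case is an
      averaging step too.\<close>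
    have "P 0" by (simp add: P_def transpose_def vec_eq_iff)
    then show ?case using S[of 0] step[of 0 0] by simp
  next
    case (Suc t)
    then show ?case using S[of "Suc t"] step[of "S t" "Suc t"] by simp
  qed
  then show "transpose (S t) = S t" "0 \<le> v \<bullet> (S t *v v)" "norm (S t *v v) \<le> G\<^sup>2 * norm v"
    by (auto simp: P_def)
qed

section \<open>Inverses of coercive matrices and their variation over a window\<close>

text \<open>By Cauchy-Schwarz, coercivity gives
  \<open>\<epsilon> * norm v \<le> norm (B *v v)\<close>. Hence \<open>B\<close> has trivial kernel,
  which in finite dimension makes it invertible, and the same inequality at
  \<open>matrix_inv B *v v\<close> bounds the inverse.\<close>

lemma coercive_matrix_inv:
  fixes B :: "real^'n^'n"
  assumes "\<epsilon> > 0" "\<And>v. \<epsilon> * (norm v)\<^sup>2 \<le> v \<bullet> (B *v v)"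
  shows "B ** matrix_inv B = mat 1" "norm (matrix_inv B *v v) \<le> norm v / \<epsilon>"
proof -
  have lower: "\<epsilon> * norm v \<le> norm (B *v v)" for v
  proof (cases "v = 0")
    case False
    have "\<epsilon> * norm v * norm v \<le> norm (B *v v) * norm v"
      using assms(2)[of v] norm_cauchy_schwarz[of v "B *v v"]
      by (simp add: power2_eq_square mult_ac)
    then show ?thesis using False by simp
  qed simp
  have "v = 0" if "B *v v = 0" for v
    using lower[of v] that assms(1) by (simp add: mult_le_0_iff)
  then have "invertible B"
    unfolding invertible_left_inverse matrix_left_invertible_ker by blast
  \<comment> \<open>\<open>matrix_inv\<close> is defined by choice, so invertibility has to come
    first.\<close>
  then show inv: "B ** matrix_inv B = mat 1"
    unfolding invertible_def matrix_inv_def by (rule someI2_ex) blast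
  then have "B *v (matrix_inv B *v v) = v"
    by (simp add: matrix_vector_mul_assoc)
  then show "norm (matrix_inv B *v v) \<le> norm v / \<epsilon>"
    using lower[of "matrix_inv B *v v"] assms(1) by (simp add: field_simps)
qed

lemma symmetric_matrix_inv:
  fixes B :: "real^'n^'n"
  assumes "transpose B = B" "B ** matrix_inv B = mat 1"
  shows "(matrix_inv B *v u) \<bullet> v = u \<bullet> (matrix_inv B *v v)"
proof -
  have "B *v (matrix_inv B *v x) = x" for x
    using assms(2) by (simp add: matrix_vector_mul_assoc)
  then show ?thesis
    using symmetric_inner[OF assms(1), of "matrix_inv B *v u" "matrix_inv B *v v"] by simp
qed

lemma norm_le_spectral_norm: "norm (A *v v) \<le> spectral_norm A * norm v"
  unfolding spectral_norm_def by (rule onorm) simp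

lemma spectral_norm_nonneg: "0 \<le> spectral_norm A"
  unfolding spectral_norm_def by (rule onorm_pos_le) simp

text \<open>A real supremum is known to dominate its members once the set is bounded above. The
  bound \<open>c\<close> on the inverses provides this: each difference has spectral norm at most
  \<open>2 * c\<close>, whatever the end of the window.\<close>

lemma inverse_variation_ge:
  fixes B :: "nat \<Rightarrow> real^'n^'n"
  assumes bound: "\<And>t v. norm (matrix_inv (B t) *v v) \<le> c * norm v"
    and t: "t \<ge> T - 1"
  shows "L2_set (\<lambda>k. spectral_norm (matrix_inv (B (t-k)) - matrix_inv (B t))) {..<T}
    \<le> inverse_variation B T"
proof -
  have le: "spectral_norm (matrix_inv (B i) - matrix_inv (B j)) \<le> 2 * c" for i j
    unfolding spectral_norm_def
  proof (rule onorm_le)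
    fix x
    have "norm (matrix_inv (B i) *v x - matrix_inv (B j) *v x) \<le> c * norm x + c * norm x"
      by (intro norm_triangle_le_diff add_mono bound)
    then show "norm ((matrix_inv (B i) - matrix_inv (B j)) *v x) \<le> 2 * c * norm x"
      by (simp add: matrix_vector_mult_diff_rdistrib)
  qed
  have "sqrt (\<Sum>k<T. (spectral_norm (matrix_inv (B (t'-k)) - matrix_inv (B t')))\<^sup>2)
      \<le> sqrt (\<Sum>k<T. (2 * c)\<^sup>2)" for t'
    by (intro real_sqrt_le_mono sum_mono power_mono le spectral_norm_nonneg)
  then show ?thesis
    unfolding inverse_variation_def L2_set_def using t
    by (intro cSUP_upper bdd_aboveI2[where M = "sqrt (\<Sum>k<T. (2 * c)\<^sup>2)"]) auto
qed

text \<open>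
  Writing \<open>D k\<close> for the deviation of \<open>matrix_inv (B (t-k))\<close> from \<open>matrix_inv (B t)\<close>,
  the vector of the values \<open>\<psi> (t-k) \<bullet> v\<close> is the vector of the values
  \<open>g (t-k) \<bullet> (matrix_inv (B t) *v v)\<close> perturbed by the \<open>g (t-k) \<bullet> (D k *v v)\<close>; the
  reverse triangle inequality in the Euclidean norm over \<open>k\<close> separates the two.
\<close>
lemma windowed_lower_bound_preconditioned:
  fixes B :: "nat \<Rightarrow> real^'n^'n" and g :: "nat \<Rightarrow> real^'n"
  assumes sym: "\<And>t. transpose (B t) = B t"
    and coercive: "\<And>t v. \<epsilon> * (norm v)\<^sup>2 \<le> v \<bullet> (B t *v v)"
    and upper: "\<And>t v. norm (B t *v v) \<le> b * norm v"
    and pos: "\<epsilon> > 0" "b > 0"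
    and g: "\<And>t. norm (g t) \<le> G"
    and obs: "windowed_lower_bound g T c"
    and c: "c > 0"
    and gap: "G * inverse_variation B T < sqrt c / b"
  shows "windowed_lower_bound (\<lambda>t. matrix_inv (B t) *v g t) T
    ((sqrt c / b - G * inverse_variation B T)\<^sup>2)"
  unfolding windowed_lower_bound_iff
proof (intro allI impI)
  fix t v
  assume t: "t \<ge> T - 1"
  note inv = coercive_matrix_inv[OF pos(1) coercive]
  have G0: "0 \<le> G" using g[of 0] norm_ge_zero[of "g 0"] by linarith
  define \<nu> where "\<nu> = inverse_variation B T"
  define x where "x = matrix_inv (B t) *v v"
  define D where "D k = matrix_inv (B (t-k)) - matrix_inv (B t)" for k
  define p where "p k = (matrix_inv (B (t-k)) *v g (t-k)) \<bullet> v" for k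
  have p: "p k = g (t-k) \<bullet> x + g (t-k) \<bullet> (D k *v v)" for k
    unfolding p_def symmetric_matrix_inv[OF sym inv(1)]
    by (simp add: D_def x_def matrix_vector_mult_diff_rdistrib inner_diff_right)
  \<comment> \<open>The upper bound on \<open>B t\<close> turns into a lower bound on its inverse;
    this is where \<open>b\<close> enters.\<close>
  have "norm v = norm (B t *v x)"
    using inv(1)[of t] by (simp add: x_def matrix_vector_mul_assoc)
  also have "\<dots> \<le> b * norm x" by (rule upper)
  finally have "norm v / b \<le> norm x"
    using pos by (simp add: field_simps)
  then have "sqrt c / b * norm v \<le> sqrt c * norm x"
    using c by (metis mult_left_mono real_sqrt_ge_zero less_imp_le times_divide_eq_left times_divide_eq_right)
  also have "\<dots> = sqrt (c * (norm x)\<^sup>2)" by (simp add: real_sqrt_mult)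
  also have "\<dots> \<le> L2_set (\<lambda>k. g (t-k) \<bullet> x) {..<T}"
    using obs t unfolding windowed_lower_bound_iff L2_set_def by simp
  also have "\<dots> = L2_set (\<lambda>k. p k + - (g (t-k) \<bullet> (D k *v v))) {..<T}"
    by (simp add: p)
  also have "\<dots> \<le> L2_set p {..<T} + L2_set (\<lambda>k. - (g (t-k) \<bullet> (D k *v v))) {..<T}"
    by (rule L2_set_triangle_ineq)
  also have "L2_set (\<lambda>k. - (g (t-k) \<bullet> (D k *v v))) {..<T} = L2_set (\<lambda>k. \<bar>g (t-k) \<bullet> (D k *v v)\<bar>) {..<T}"
    by (simp add: L2_set_def)
  also have "\<dots> \<le> L2_set (\<lambda>k. G * norm v * spectral_norm (D k)) {..<T}"
  proof (rule L2_set_mono)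
    fix k
    have "\<bar>g (t-k) \<bullet> (D k *v v)\<bar> \<le> norm (g (t-k)) * norm (D k *v v)"
      by (rule Cauchy_Schwarz_ineq2)
    also have "\<dots> \<le> G * (spectral_norm (D k) * norm v)"
      using g G0 norm_le_spectral_norm by (intro mult_mono) auto
    finally show "\<bar>g (t-k) \<bullet> (D k *v v)\<bar> \<le> G * norm v * spectral_norm (D k)" by (simp add: mult_ac)
  qed simp
  also have "\<dots> = G * norm v * L2_set (\<lambda>k. spectral_norm (D k)) {..<T}"
    using G0 by (simp add: L2_set_right_distrib)
  also have "\<dots> \<le> G * norm v * \<nu>"
    unfolding \<nu>_def D_def using G0 inv(2) t
    by (intro mult_left_mono inverse_variation_ge[where c = "1 / \<epsilon>"]) auto
  finally have "(sqrt c / b - G * \<nu>) * norm v \<le> L2_set p {..<T}"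
    by (simp add: algebra_simps)
  \<comment> \<open>Squaring is monotone here because \<open>gap\<close> makes the left factor
    nonnegative.\<close>
  then have "((sqrt c / b - G * \<nu>) * norm v)\<^sup>2 \<le> (L2_set p {..<T})\<^sup>2"
    using gap by (intro power_mono) (auto simp: \<nu>_def)
  also have "\<dots> = (\<Sum>k<T. (p k)\<^sup>2)"
    by (simp add: L2_set_def sum_nonneg)
  finally show "(sqrt c / b - G * inverse_variation B T)\<^sup>2 * (norm v)\<^sup>2
      \<le> (\<Sum>k<T. ((matrix_inv (B (t-k)) *v g (t-k)) \<bullet> v)\<^sup>2)"
    by (simp add: \<nu>_def p_def power_mult_distrib)
qed

section \<open>Energy and drift estimates for an abstract iteration\<close>

text \<open>Isolates the one-step facts behind the energy estimates. The preconditioner enters only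
  through the bound \<open>K\<close> on the directions, later \<open>G / \<epsilon>\<close>, and
  \<open>small_step\<close> is the first upper bound on \<eta> in that notation.\<close>

locale sector_iteration =
  fixes e \<psi> :: "nat \<Rightarrow> 'a::real_inner"
    and s r :: "nat \<Rightarrow> real"
    and \<eta> m M K D :: real
  assumes step: "\<And>t. e (Suc t) = e t - (\<eta> * s t) *\<^sub>R \<psi> t"
    and direction_bound: "\<And>t. norm (\<psi> t) \<le> K"
    and feedback_lower: "\<And>t. m * (r t)\<^sup>2 \<le> r t * s t"
    and feedback_upper: "\<And>t. \<bar>s t\<bar> \<le> M * \<bar>r t\<bar>"
    and mismatch: "\<And>t. \<bar>r t - \<psi> t \<bullet> e t\<bar> \<le> D"
    and pos: "\<eta> > 0" "m > 0" "M > 0" "K > 0"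
    and small_step: "2 * \<eta> * M\<^sup>2 * K\<^sup>2 \<le> m"
begin

text \<open>Per step, \<open>\<alpha>0\<close> is the rate at which the squared residual lowers the
  squared error, and \<open>\<gamma>0\<close> is the price of the squared mismatch bound.\<close>

definition "\<alpha>0 = \<eta> * m / 2"
definition "\<gamma>0 = \<eta> * M\<^sup>2 / m"

lemma D_nonneg: "0 \<le> D"
  using mismatch[of 0] by linarith

lemma coeffs_pos: "\<alpha>0 > 0" "\<gamma>0 > 0"
  using pos by (simp_all add: \<alpha>0_def \<gamma>0_def)

text \<open>Expand the square and write the signal as \<open>r t - d\<close>. Up to the factor
  \<eta>, the sector condition gains \<open>2 * m * (r t)\<^sup>2\<close>; the mismatch costs at
  most half of that plus a multiple of \<open>D\<^sup>2\<close>, and the second-order term at most a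
  quarter by \<open>small_step\<close>. A quarter remains.\<close>

lemma energy_step: "(norm (e (Suc t)))\<^sup>2 \<le> (norm (e t))\<^sup>2 - \<alpha>0 * (r t)\<^sup>2 + \<gamma>0 * D\<^sup>2"
proof -
  define d where "d = r t - \<psi> t \<bullet> e t"
  have exp: "(norm (e (Suc t)))\<^sup>2 = (norm (e t))\<^sup>2 - 2 * \<eta> * (r t * s t) + \<eta> * (2 * (s t * d))
      + \<eta> * (\<eta> * (s t)\<^sup>2 * (norm (\<psi> t))\<^sup>2)"
    unfolding step d_def power2_norm_eq_inner
    by (simp add: inner_diff inner_commute algebra_simps power2_eq_square)
  have s2: "(s t)\<^sup>2 \<le> M\<^sup>2 * (r t)\<^sup>2"
    using power_mono[OF feedback_upper[of t], of 2] by (simp add: power_mult_distrib)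
  have psi2: "(norm (\<psi> t))\<^sup>2 \<le> K\<^sup>2"
    using direction_bound by (intro power_mono) auto
  have "\<eta> * (s t)\<^sup>2 * (norm (\<psi> t))\<^sup>2 \<le> \<eta> * (M\<^sup>2 * (r t)\<^sup>2) * K\<^sup>2"
    using s2 psi2 pos by (intro mult_mono) auto
  also have "\<dots> = (2 * \<eta> * M\<^sup>2 * K\<^sup>2) * ((r t)\<^sup>2 / 2)" by simp
  also have "\<dots> \<le> m * ((r t)\<^sup>2 / 2)"
    using small_step by (intro mult_right_mono) auto
  finally have quad: "\<eta> * (s t)\<^sup>2 * (norm (\<psi> t))\<^sup>2 \<le> m * (r t)\<^sup>2 / 2" by simp
  have "s t * d \<le> \<bar>s t\<bar> * \<bar>d\<bar>"
    by (metis abs_ge_self abs_mult)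
  also have "\<dots> \<le> (M * \<bar>r t\<bar>) * D"
    using feedback_upper mismatch pos unfolding d_def by (intro mult_mono) auto
  \<comment> \<open>Multiplying by \<open>m\<close> prepares
    \<open>2 * x * y \<le> x\<^sup>2 + y\<^sup>2\<close> with \<open>x = m * \<bar>r t\<bar>\<close>
    and \<open>y = M * D\<close>, the weighting that spends exactly half of the sector gain.\<close>
  finally have "m * (2 * (s t * d)) \<le> m * (2 * (M * \<bar>r t\<bar> * D))"
    using pos by simp
  also have "\<dots> \<le> m\<^sup>2 * (r t)\<^sup>2 + M\<^sup>2 * D\<^sup>2"
    using sum_squares_bound[of "m * \<bar>r t\<bar>" "M * D"]
    by (simp add: power_mult_distrib algebra_simps)
  finally have cross: "2 * (s t * d) \<le> m * (r t)\<^sup>2 + M\<^sup>2 * D\<^sup>2 / m"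
    using pos by (simp add: field_simps power2_eq_square)
  have "- 2 * (r t * s t) + 2 * (s t * d) + \<eta> * (s t)\<^sup>2 * (norm (\<psi> t))\<^sup>2
      \<le> - (m / 2) * (r t)\<^sup>2 + M\<^sup>2 * D\<^sup>2 / m"
    using quad cross feedback_lower[of t] by (simp add: field_simps)
  then have "\<eta> * (- 2 * (r t * s t) + 2 * (s t * d) + \<eta> * (s t)\<^sup>2 * (norm (\<psi> t))\<^sup>2)
      \<le> \<eta> * (- (m / 2) * (r t)\<^sup>2 + M\<^sup>2 * D\<^sup>2 / m)"
    using pos by (intro mult_left_mono) auto
  then show ?thesis
    unfolding exp \<alpha>0_def \<gamma>0_def by (simp add: algebra_simps)
qed

lemma energy_window:
  "(norm (e (a + n)))\<^sup>2 + \<alpha>0 * (\<Sum>j<n. (r (a + j))\<^sup>2) \<le> (norm (e a))\<^sup>2 + real n * \<gamma>0 * D\<^sup>2"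
proof (induction n)
  case (Suc n)
  then show ?case
    using energy_step[of "a + n"] by (simp add: algebra_simps)
qed simp

lemma residual_sum_bound:
  "(\<Sum>j<n. (r (a + j))\<^sup>2) \<le> ((norm (e a))\<^sup>2 + real n * \<gamma>0 * D\<^sup>2) / \<alpha>0"
proof -
  have "\<alpha>0 * (\<Sum>j<n. (r (a + j))\<^sup>2) \<le> (norm (e a))\<^sup>2 + real n * \<gamma>0 * D\<^sup>2"
    using energy_window[of a n] zero_le_power2[of "norm (e (a + n))"] by linarith
  then show ?thesis
    using coeffs_pos by (simp add: field_simps)
qed

lemma drift_sum: "norm (e (a + n) - e a) \<le> \<eta> * (K * M) * (\<Sum>j<n. \<bar>r (a + j)\<bar>)"
proof (induction n)
  case (Suc n)
  have "\<bar>s (a + n)\<bar> * norm (\<psi> (a + n)) \<le> (M * \<bar>r (a + n)\<bar>) * K"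
    using feedback_upper direction_bound pos by (intro mult_mono) auto
  then have "\<eta> * (\<bar>s (a + n)\<bar> * norm (\<psi> (a + n))) \<le> \<eta> * ((M * \<bar>r (a + n)\<bar>) * K)"
    using pos by simp
  then have "norm ((\<eta> * s (a + n)) *\<^sub>R \<psi> (a + n)) \<le> \<eta> * (K * M) * \<bar>r (a + n)\<bar>"
    using pos by (simp add: abs_mult mult_ac)
  moreover have "e (a + Suc n) - e a = (e (a + n) - e a) - (\<eta> * s (a + n)) *\<^sub>R \<psi> (a + n)"
    by (simp add: step)
  then have "norm (e (a + Suc n) - e a) \<le> norm (e (a + n) - e a) + norm ((\<eta> * s (a + n)) *\<^sub>R \<psi> (a + n))"
    by (simp only: norm_triangle_ineq4)
  ultimately show ?case
    using Suc by (simp add: algebra_simps)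
qed simp

text \<open>Cauchy-Schwarz trades the sum of absolute residuals for the root of \<open>T\<close>
  times their sum of squares. Summing over the whole window makes the bound the same for all
  \<open>n \<le> T\<close>.\<close>

lemma drift:
  assumes "n \<le> T"
  shows "norm (e (a + n) - e a) \<le> \<eta> * (K * M) * sqrt (real T * (\<Sum>j<T. (r (a + j))\<^sup>2))"
proof -
  have "(\<Sum>j<n. \<bar>r (a + j)\<bar>) \<le> (\<Sum>j<T. \<bar>r (a + j)\<bar>)"
    using assms by (intro sum_mono2) auto
  also have "\<dots> \<le> sqrt (real T * (\<Sum>j<T. (r (a + j))\<^sup>2))"
    using sum_squared_le_sum_of_squares[of "\<lambda>j. \<bar>r (a + j)\<bar>" "{..<T}"]
    by (intro real_le_rsqrt) (simp add: mult.commute)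
  finally have "\<eta> * (K * M) * (\<Sum>j<n. \<bar>r (a + j)\<bar>) \<le> \<eta> * (K * M) * sqrt (real T * (\<Sum>j<T. (r (a + j))\<^sup>2))"
    using pos by (intro mult_left_mono) auto
  then show ?thesis
    using drift_sum[of a n] by linarith
qed

text \<open>Inserting the energy bound on the residuals into the drift bound and splitting the
  square root separates the starting error from the mismatch. The factor of
  \<open>norm (e a)\<close> becomes the constant \<open>A\<close>.\<close>

lemma within_window:
  assumes "n \<le> T"
  shows "norm (e (a + n)) \<le> (1 + \<eta> * (K * M) * sqrt (real T / \<alpha>0)) * norm (e a)
    + \<eta> * (K * M) * real T * sqrt (\<gamma>0 / \<alpha>0) * D"
proof -
  have "real T * (\<Sum>j<T. (r (a + j))\<^sup>2) \<le> real T * (((norm (e a))\<^sup>2 + real T * \<gamma>0 * D\<^sup>2) / \<alpha>0)"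
    by (intro mult_left_mono residual_sum_bound) auto
  also have "\<dots> = (real T / \<alpha>0) * (norm (e a))\<^sup>2 + ((real T)\<^sup>2 * (\<gamma>0 / \<alpha>0)) * D\<^sup>2"
    using coeffs_pos by (simp add: field_simps power2_eq_square)
  finally have "sqrt (real T * (\<Sum>j<T. (r (a + j))\<^sup>2))
      \<le> sqrt ((real T / \<alpha>0) * (norm (e a))\<^sup>2 + ((real T)\<^sup>2 * (\<gamma>0 / \<alpha>0)) * D\<^sup>2)"
    by simp
  also have "\<dots> \<le> sqrt ((real T / \<alpha>0) * (norm (e a))\<^sup>2) + sqrt (((real T)\<^sup>2 * (\<gamma>0 / \<alpha>0)) * D\<^sup>2)"
    using coeffs_pos by (intro sqrt_add_le_add_sqrt) auto
  also have "\<dots> = sqrt (real T / \<alpha>0) * norm (e a) + real T * sqrt (\<gamma>0 / \<alpha>0) * D"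
    using D_nonneg by (simp add: real_sqrt_mult real_sqrt_divide)
  finally have "\<eta> * (K * M) * sqrt (real T * (\<Sum>j<T. (r (a + j))\<^sup>2))
      \<le> \<eta> * (K * M) * (sqrt (real T / \<alpha>0) * norm (e a) + real T * sqrt (\<gamma>0 / \<alpha>0) * D)"
    using pos by (intro mult_left_mono) auto
  moreover have "norm (e (a + n)) \<le> norm (e a) + norm (e (a + n) - e a)"
    by (metis add_diff_cancel_left' add.commute diff_add_cancel norm_triangle_ineq)
  ultimately show ?thesis
    using drift[OF assms, of a] by (simp add: algebra_simps)
qed

text \<open>
  Freezing the error at the start of the window costs only drift terms, which the
  energy estimate controls through the residuals themselves.
\<close>
lemma window_contraction:
  fixes \<mu> :: real
  assumes obs: "\<mu> * (norm (e a))\<^sup>2 \<le> (\<Sum>k<T. (\<psi> (a + k) \<bullet> e a)\<^sup>2)"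
    and \<alpha>: "\<alpha> = \<eta> * m / 4"
    and \<gamma>: "\<gamma> = \<alpha>0 + \<gamma>0"
    and \<theta>: "\<theta> = \<mu> / 2 - 2 * \<eta> * K ^ 4 * M\<^sup>2 * (real T)\<^sup>2 / m"
    and \<zeta>: "\<zeta> = 2 * \<eta>\<^sup>2 * K ^ 4 * M ^ 4 * (real T) ^ 3 / m\<^sup>2"
  shows "(norm (e (a + T)))\<^sup>2 \<le> (1 - \<alpha> * \<theta>) * (norm (e a))\<^sup>2 + (\<alpha> * \<zeta> + \<gamma> * real T) * D\<^sup>2"
proof -
  define X where "X = (norm (e a))\<^sup>2"
  define R where "R = (\<Sum>k<T. (r (a + k))\<^sup>2)"
  define Q where "Q = (\<Sum>k<T. (\<psi> (a + k) \<bullet> e (a + k))\<^sup>2)"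
  \<comment> \<open>\<open>c * R\<close> will bound the squared effect of drift on one signal:
    \<open>c\<close> is \<open>T\<close> times the square of
    \<open>K * (\<eta> * (K * M))\<close>.\<close>
  define c where "c = K ^ 4 * \<eta>\<^sup>2 * M\<^sup>2 * real T"
  have R0: "0 \<le> R" and c0: "0 \<le> c"
    by (auto simp: R_def c_def intro!: sum_nonneg)
  have alpha0: "\<alpha>0 = 2 * \<alpha>" "\<alpha> > 0"
    using pos by (auto simp: \<alpha>0_def \<alpha>)
  have "Q \<le> (\<Sum>k<T. 2 * (r (a + k))\<^sup>2 + 2 * D\<^sup>2)"
    unfolding Q_def
  proof (rule sum_mono)
    fix k
    define d where "d = r (a + k) - \<psi> (a + k) \<bullet> e (a + k)"
    have "d\<^sup>2 \<le> D\<^sup>2"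
      using mismatch[of "a + k"] D_nonneg unfolding d_def by (simp add: abs_le_square_iff[symmetric])
    moreover have "0 \<le> (r (a + k) + d)\<^sup>2" by simp
    moreover have "\<psi> (a + k) \<bullet> e (a + k) = r (a + k) - d" by (simp add: d_def)
    ultimately show "(\<psi> (a + k) \<bullet> e (a + k))\<^sup>2 \<le> 2 * (r (a + k))\<^sup>2 + 2 * D\<^sup>2"
      by (simp add: power2_diff power2_sum)
  qed
  then have Q_le: "Q \<le> 2 * R + 2 * real T * D\<^sup>2"
    by (simp add: R_def sum.distrib sum_distrib_left mult_ac)
  have "(\<Sum>k<T. (\<psi> (a + k) \<bullet> e a)\<^sup>2) \<le> (\<Sum>k<T. 2 * (\<psi> (a + k) \<bullet> e (a + k))\<^sup>2 + 2 * (c * R))"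
  proof (rule sum_mono)
    fix k
    assume "k \<in> {..<T}"
    define p where "p = \<psi> (a + k) \<bullet> e (a + k)"
    define z where "z = \<psi> (a + k) \<bullet> (e (a + k) - e a)"
    have "\<bar>z\<bar> \<le> norm (\<psi> (a + k)) * norm (e (a + k) - e a)"
      unfolding z_def by (rule Cauchy_Schwarz_ineq2)
    also have "\<dots> \<le> K * (\<eta> * (K * M) * sqrt (real T * R))"
      using direction_bound drift[of k T a] \<open>k \<in> {..<T}\<close> pos unfolding R_def
      by (intro mult_mono) auto
    finally have "z\<^sup>2 \<le> (K * (\<eta> * (K * M) * sqrt (real T * R)))\<^sup>2"
      by (metis abs_ge_zero power2_abs power_mono)
    also have "\<dots> = c * R"
      using R0 by (simp add: c_def power_mult_distrib power2_eq_square power4_eq_xxxx)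
    finally have "z\<^sup>2 \<le> c * R" .
    moreover have "\<psi> (a + k) \<bullet> e a = p - z"
      by (simp add: p_def z_def inner_diff_right)
    moreover have "0 \<le> (p + z)\<^sup>2" by simp
    ultimately show "(\<psi> (a + k) \<bullet> e a)\<^sup>2 \<le> 2 * (\<psi> (a + k) \<bullet> e (a + k))\<^sup>2 + 2 * (c * R)"
      unfolding p_def[symmetric] by (simp add: power2_diff power2_sum)
  qed
  then have "\<mu> * X \<le> 2 * Q + 2 * (real T * c * R)"
    using obs by (simp add: X_def Q_def sum.distrib sum_distrib_left mult_ac)
  moreover have "real T * c * R \<le> real T * c * ((X + real T * \<gamma>0 * D\<^sup>2) / \<alpha>0)"
    unfolding R_def X_def using c0 by (intro mult_left_mono residual_sum_bound) auto
  \<comment> \<open>The origin of \<theta> and \<zeta>: the coefficient of \<open>X\<close> is what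
    drift takes away from the \<open>\<mu> / 2\<close> supplied by observability, and \<zeta> is the
    share of drift due to mismatch.\<close>
  moreover have "real T * c * ((X + real T * \<gamma>0 * D\<^sup>2) / \<alpha>0) = (\<mu> / 2 - \<theta>) * X + \<zeta> * D\<^sup>2"
    using pos unfolding c_def \<alpha>0_def \<gamma>0_def \<theta> \<zeta>
    by (simp add: field_simps) (simp add: power2_eq_square power3_eq_cube power4_eq_xxxx algebra_simps)
  ultimately have "\<theta> * X - \<zeta> * D\<^sup>2 \<le> Q"
    by (simp add: algebra_simps)
  \<comment> \<open>As \<alpha> is half of \<open>\<alpha>0\<close>, the term \<open>2 * R\<close>
    becomes exactly the decrease \<open>\<alpha>0 * R\<close> of the energy estimate, and the other
    term contributes the summand \<open>\<alpha>0\<close> of \<gamma>.\<close>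
  then have "\<alpha> * (\<theta> * X - \<zeta> * D\<^sup>2) \<le> \<alpha> * (2 * R + 2 * real T * D\<^sup>2)"
    using Q_le alpha0 by simp
  then show ?thesis
    using energy_window[of a T] unfolding R_def[symmetric] X_def[symmetric] \<gamma> alpha0(1)
    by (simp add: algebra_simps)
qed

text \<open>At multiples of \<open>T\<close> the squared error obeys an affine recursion with factor
  \<open>q\<^sup>2\<close>. Taking roots gives the rate \<open>q\<close> per window, and the
  remaining \<open>t mod T\<close> steps cost the factor \<open>A\<close> and the last summand of
  \<open>L\<close>.\<close>

lemma geometric_bound:
  fixes \<mu> :: real
  assumes T: "T \<ge> 1"
    and obs: "\<And>a v. \<mu> * (norm v)\<^sup>2 \<le> (\<Sum>k<T. (\<psi> (a + k) \<bullet> v)\<^sup>2)"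
    and \<mu>: "0 < \<mu>" "\<eta> < 8 / (m * \<mu>)" "4 * \<eta> * K ^ 4 * M\<^sup>2 * (real T)\<^sup>2 < \<mu> * m"
    and \<alpha>: "\<alpha> = \<eta> * m / 4"
    and \<gamma>: "\<gamma> = \<alpha>0 + \<gamma>0"
    and \<theta>: "\<theta> = \<mu> / 2 - 2 * \<eta> * K ^ 4 * M\<^sup>2 * (real T)\<^sup>2 / m"
    and \<zeta>: "\<zeta> = 2 * \<eta>\<^sup>2 * K ^ 4 * M ^ 4 * (real T) ^ 3 / m\<^sup>2"
    and q: "q = sqrt (1 - \<alpha> * \<theta>)"
    and A: "A = 1 + \<eta> * (K * M) * sqrt (real T / \<alpha>0)"
    and L: "L = A * sqrt ((\<alpha> * \<zeta> + \<gamma> * real T) / (\<alpha> * \<theta>))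
                + \<eta> * (K * M) * real T * sqrt (\<gamma>0 / \<alpha>0)"
  shows "0 < q \<and> q < 1 \<and> 0 < A \<and> 0 < L \<and>
    (\<forall>t. norm (e t) \<le> A * q ^ (t div T) * norm (e 0) + L * D)"
proof -
  have "\<alpha> > 0" using pos by (simp add: \<alpha>)
  have "\<theta> > 0" using pos \<mu>(3) by (simp add: \<theta> field_simps)
  \<comment> \<open>Dropping the drift part of \<theta> leaves
    \<open>\<eta> * m * \<mu> / 8\<close>, which is below 1 by the bound
    \<open>8 / (m * \<mu>)\<close> on \<eta>.\<close>
  have "\<alpha> * \<theta> \<le> \<alpha> * (\<mu> / 2)"
    using \<open>\<alpha> > 0\<close> pos by (intro mult_left_mono) (auto simp: \<theta>)
  also have "\<dots> < 1"
    using pos \<mu>(1,2) by (simp add: \<alpha> field_simps)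
  finally have at: "0 < \<alpha> * \<theta>" "\<alpha> * \<theta> < 1"
    using \<open>\<alpha> > 0\<close> \<open>\<theta> > 0\<close> by auto
  have q01: "0 < q" "q < 1" using at by (auto simp: q)
  have q2: "q\<^sup>2 = 1 - \<alpha> * \<theta>" using at by (simp add: q)
  have "\<zeta> \<ge> 0" "\<gamma> > 0"
    using pos coeffs_pos by (auto simp: \<zeta> \<gamma>)
  \<comment> \<open>The fixed point of the recursion for the coefficient of
    \<open>D\<^sup>2\<close>: \<open>q\<^sup>2 * c + \<alpha> * \<theta> * c = c\<close>, so the
    induction below reproduces the same constant.\<close>
  define c where "c = (\<alpha> * \<zeta> + \<gamma> * real T) / (\<alpha> * \<theta>)"
  have c0: "c > 0"
    using at \<open>\<zeta> \<ge> 0\<close> \<open>\<gamma> > 0\<close> \<open>\<alpha> > 0\<close> T unfolding c_def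
    by (intro divide_pos_pos add_nonneg_pos) auto
  have A0: "A > 0"
    using pos coeffs_pos unfolding A by (intro add_pos_nonneg) auto
  have L0: "L > 0"
    using A0 c0 pos coeffs_pos unfolding L c_def[symmetric]
    by (intro add_pos_nonneg) auto
  have energy: "(norm (e (n * T)))\<^sup>2 \<le> (q ^ n * norm (e 0))\<^sup>2 + c * D\<^sup>2" for n
  proof (induction n)
    case 0
    then show ?case using c0 by simp
  next
    case (Suc n)
    have "(norm (e (n * T + T)))\<^sup>2 \<le> q\<^sup>2 * (norm (e (n * T)))\<^sup>2 + (\<alpha> * \<theta> * c) * D\<^sup>2"
      using window_contraction[OF obs \<alpha> \<gamma> \<theta> \<zeta>, of "n * T"] \<open>\<alpha> > 0\<close> \<open>\<theta> > 0\<close>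
      by (simp add: q2 c_def)
    also have "\<dots> \<le> q\<^sup>2 * ((q ^ n * norm (e 0))\<^sup>2 + c * D\<^sup>2) + (\<alpha> * \<theta> * c) * D\<^sup>2"
      using Suc by (intro add_right_mono mult_left_mono) auto
    also have "\<dots> = q\<^sup>2 * (q ^ n * norm (e 0))\<^sup>2 + (q\<^sup>2 + \<alpha> * \<theta>) * (c * D\<^sup>2)"
      by (simp add: algebra_simps)
    also have "\<dots> = (q ^ Suc n * norm (e 0))\<^sup>2 + c * D\<^sup>2"
      by (simp add: q2 power_mult_distrib)
    finally show ?case by (simp add: add.commute)
  qed
  have multiples: "norm (e (n * T)) \<le> q ^ n * norm (e 0) + sqrt c * D" for n
  proof -
    have "norm (e (n * T)) \<le> sqrt ((q ^ n * norm (e 0))\<^sup>2 + c * D\<^sup>2)"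
      using energy by (rule real_le_rsqrt)
    also have "\<dots> \<le> sqrt ((q ^ n * norm (e 0))\<^sup>2) + sqrt (c * D\<^sup>2)"
      using c0 by (intro sqrt_add_le_add_sqrt) auto
    also have "\<dots> = q ^ n * norm (e 0) + sqrt c * D"
      using q01 D_nonneg by (simp add: real_sqrt_mult)
    finally show ?thesis .
  qed
  have "norm (e t) \<le> A * q ^ (t div T) * norm (e 0) + L * D" for t
  proof -
    have "norm (e (t div T * T + t mod T)) \<le> A * norm (e (t div T * T)) + \<eta> * (K * M) * real T * sqrt (\<gamma>0 / \<alpha>0) * D"
      unfolding A using T by (intro within_window) (simp add: less_imp_le)
    also have "\<dots> \<le> A * (q ^ (t div T) * norm (e 0) + sqrt c * D) + \<eta> * (K * M) * real T * sqrt (\<gamma>0 / \<alpha>0) * D"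
      using multiples A0 by (intro add_right_mono mult_left_mono) auto
    finally show ?thesis
      by (simp add: L c_def algebra_simps)
  qed
  then show ?thesis using q01 A0 L0 by blast
qed

end

section \<open>The learning dynamics as an instance\<close>

theorem proposition1:
  fixes f :: "real^'d \<Rightarrow> 'x \<Rightarrow> real"
    and inp :: "nat \<Rightarrow> 'x"
    and y :: "nat \<Rightarrow> real"
    and loss :: "nat \<Rightarrow> real \<Rightarrow> real \<Rightarrow> real"
    and \<eta> \<beta> \<epsilon> :: real
    and w g e \<psi> :: "nat \<Rightarrow> real^'d"
    and w_ref :: "real^'d"
    and yhat s r chi \<delta> :: "nat \<Rightarrow> real"
    and S B :: "nat \<Rightarrow> real^'d^'d"
    and G m M \<delta>bar :: real
    and \<phi> :: "real \<Rightarrow> real"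
    and T :: nat
  assumes f_differentiable: "\<And>z v. (\<lambda>v. f v z) differentiable (at v)"
    and loss_differentiable: "\<And>t b a. (\<lambda>a. loss t a b) differentiable (at a)"
    and eta_pos: "\<eta> > 0"
    and beta: "0 < \<beta>" "\<beta> < 1"
    and eps_pos: "\<epsilon> > 0"
    and yhat: "\<And>t. yhat t = f (w t) (inp t)"
    and g: "\<And>t. g t = gradient (\<lambda>v. f v (inp t)) (w t)"
    and s: "\<And>t. s t = deriv (\<lambda>a. loss t a (y t)) (yhat t)"
    and S: "\<And>t. S t = \<beta> *\<^sub>R (if t = 0 then 0 else S (t-1)) + (1 - \<beta>) *\<^sub>R outer (g t) (g t)"
    and B: "\<And>t. B t = S t + \<epsilon> *\<^sub>R mat 1"
    and update: "\<And>t. w (t+1) = w t - \<eta> *\<^sub>R (matrix_inv (B t) *v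
                    gradient (\<lambda>v. loss t (f v (inp t)) (y t)) (w t))"
    and e: "\<And>t. e t = w t - w_ref"
    and r: "\<And>t. r t = yhat t - y t"
    and \<psi>: "\<And>t. \<psi> t = matrix_inv (B t) *v g t"
    and chi: "\<And>t. chi t = \<psi> t \<bullet> e t"
    and \<delta>: "\<And>t. \<delta> t = r t - chi t"
    and G_pos: "G > 0"
    and bounded_sensitivity: "\<And>t. norm (g t) \<le> G"
    and mM_pos: "m > 0" "M > 0"
    and feedback: "\<And>t. s t = \<phi> (r t)"
    and sector: "\<And>z. m * z\<^sup>2 \<le> z * \<phi> z" "\<And>z. z * \<phi> z \<le> M * z\<^sup>2" "\<And>z. \<bar>\<phi> z\<bar> \<le> M * \<bar>z\<bar>"
    and bounded_mismatch: "\<And>t. \<bar>\<delta> t\<bar> \<le> \<delta>bar"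
    and T: "T \<ge> 1"
  shows "let b_lo = \<epsilon>; b_hi = \<epsilon> + G\<^sup>2; \<nu> = inverse_variation B T;
             alternative = (\<lambda>lam. lam > 0 \<and> windowed_lower_bound g T lam \<and> G * \<nu> < sqrt lam / b_hi);
             mu_alt = (\<lambda>lam. (sqrt lam / b_hi - G * \<nu>)\<^sup>2)
         in
         (\<forall>\<mu>. (\<mu> > 0 \<and> windowed_lower_bound \<psi> T \<mu> \<or> (\<exists>lam. alternative lam \<and> \<mu> = mu_alt lam)) \<and>
              \<eta> < min (m * b_lo\<^sup>2 / (2 * M\<^sup>2 * G\<^sup>2))
                   (min (\<mu> * m * b_lo^4 / (4 * G^4 * M\<^sup>2 * (real T)\<^sup>2)) (8 / (m * \<mu>)))
            \<longrightarrow>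
              (\<exists>q A L. 0 < q \<and> q < 1 \<and> 0 < A \<and> 0 < L \<and>
                 (\<forall>t. norm (e t) \<le> A * q ^ (t div T) * norm (e 0) + L * \<delta>bar)) \<and>
              (let \<alpha>0 = \<eta> * m / 2;
                   \<gamma>0 = \<eta> * M\<^sup>2 / m;
                   \<alpha> = \<eta> * m / 4;
                   \<gamma> = \<alpha>0 + \<gamma>0;
                   \<theta> = \<mu> / 2 - 2 * \<eta> * G^4 * M\<^sup>2 * (real T)\<^sup>2 / (m * b_lo^4);
                   \<zeta> = 2 * \<eta>\<^sup>2 * G^4 * M^4 * (real T)^3 / (m\<^sup>2 * b_lo^4);
                   q = sqrt (1 - \<alpha> * \<theta>);
                   A = 1 + \<eta> * (G * M / b_lo) * sqrt (real T / \<alpha>0);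
                   L = A * sqrt ((\<alpha> * \<zeta> + \<gamma> * real T) / (\<alpha> * \<theta>))
                       + \<eta> * (G * M / b_lo) * real T * sqrt (\<gamma>0 / \<alpha>0)
               in 0 < q \<and> q < 1 \<and> 0 < A \<and> 0 < L \<and>
                  (\<forall>t. norm (e t) \<le> A * q ^ (t div T) * norm (e 0) + L * \<delta>bar))) \<and>
         (\<forall>lam. alternative lam \<longrightarrow> mu_alt lam > 0 \<and> windowed_lower_bound \<psi> T (mu_alt lam))"
proof -
  have S_sym: "transpose (S t) = S t" and S_nonneg: "0 \<le> v \<bullet> (S t *v v)"
    and S_le: "norm (S t *v v) \<le> G\<^sup>2 * norm v" for t v
    using moving_average_bounds[OF S _ _ bounded_sensitivity] beta by auto
  have B_mult: "B t *v v = S t *v v + \<epsilon> *\<^sub>R v" for t v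
    by (simp add: B matrix_vector_mult_add_rdistrib scaleR_matrix_vector_assoc[symmetric])
  have B_sym: "transpose (B t) = B t" for t
  proof -
    have "transpose (B t) = transpose (S t) + \<epsilon> *\<^sub>R mat 1"
      unfolding B by (auto simp: transpose_def vec_eq_iff mat_def)
    then show ?thesis by (simp add: S_sym B)
  qed
  have B_ge: "\<epsilon> * (norm v)\<^sup>2 \<le> v \<bullet> (B t *v v)" for t v
    using S_nonneg[of v t] by (simp add: B_mult inner_add_right power2_norm_eq_inner)
  have B_le: "norm (B t *v v) \<le> (\<epsilon> + G\<^sup>2) * norm v" for t v
    unfolding B_mult using S_le[of t v] eps_pos norm_triangle_ineq[of "S t *v v" "\<epsilon> *\<^sub>R v"]
    by (simp add: algebra_simps)
  have \<psi>_le: "norm (\<psi> t) \<le> G / \<epsilon>" for t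
    using coercive_matrix_inv(2)[OF eps_pos B_ge, of t "g t"] bounded_sensitivity[of t] eps_pos
    unfolding \<psi> by (meson divide_right_mono less_imp_le order_trans)
  have step: "e (Suc t) = e t - (\<eta> * s t) *\<^sub>R \<psi> t" for t
  proof -
    have "gradient (\<lambda>v. loss t (f v (inp t)) (y t)) (w t) = s t *\<^sub>R g t"
      unfolding s g yhat
      using gradient_compose[where h = "\<lambda>v. f v (inp t)" and l = "\<lambda>a. loss t a (y t)", OF f_differentiable loss_differentiable] .
    then show ?thesis
      using update[of t] by (simp add: e \<psi> matrix_vector_mult_scaleR)
  qed
  have bound: "0 < q \<and> q < 1 \<and> 0 < A \<and> 0 < L \<and>
      (\<forall>t. norm (e t) \<le> A * q ^ (t div T) * norm (e 0) + L * \<delta>bar)"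
    if \<mu>: "\<mu> > 0" and obs: "windowed_lower_bound \<psi> T \<mu>"
      and \<eta>: "\<eta> < min (m * \<epsilon>\<^sup>2 / (2 * M\<^sup>2 * G\<^sup>2))
                   (min (\<mu> * m * \<epsilon>^4 / (4 * G^4 * M\<^sup>2 * (real T)\<^sup>2)) (8 / (m * \<mu>)))"
      and q: "q = sqrt (1 - (\<eta> * m / 4) * \<theta>)"
      and A: "A = 1 + \<eta> * (G * M / \<epsilon>) * sqrt (real T / (\<eta> * m / 2))"
      and L: "L = A * sqrt (((\<eta> * m / 4) * \<zeta> + (\<eta> * m / 2 + \<eta> * M\<^sup>2 / m) * real T) / ((\<eta> * m / 4) * \<theta>))
                + \<eta> * (G * M / \<epsilon>) * real T * sqrt ((\<eta> * M\<^sup>2 / m) / (\<eta> * m / 2))"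
      and \<theta>: "\<theta> = \<mu> / 2 - 2 * \<eta> * G^4 * M\<^sup>2 * (real T)\<^sup>2 / (m * \<epsilon>^4)"
      and \<zeta>: "\<zeta> = 2 * \<eta>\<^sup>2 * G^4 * M^4 * (real T)^3 / (m\<^sup>2 * \<epsilon>^4)"
    for \<mu> \<theta> \<zeta> q A L
  proof -
    interpret sector_iteration e \<psi> s r \<eta> m M "G / \<epsilon>" \<delta>bar
    proof
      show "m * (r t)\<^sup>2 \<le> r t * s t" "\<bar>s t\<bar> \<le> M * \<bar>r t\<bar>" for t
        using sector by (simp_all add: feedback)
      show "\<bar>r t - \<psi> t \<bullet> e t\<bar> \<le> \<delta>bar" for t
        using bounded_mismatch[of t] by (simp add: \<delta> chi)
      have "\<eta> * (2 * M\<^sup>2 * G\<^sup>2) < m * \<epsilon>\<^sup>2"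
        using \<eta> mM_pos G_pos by (simp add: pos_less_divide_eq)
      then show "2 * \<eta> * M\<^sup>2 * (G / \<epsilon>)\<^sup>2 \<le> m"
        using eps_pos by (simp add: field_simps power_divide)
    qed (use step \<psi>_le eta_pos mM_pos G_pos eps_pos in auto)
    \<comment> \<open>The second bound on \<eta>, rewritten with \<open>G / \<epsilon>\<close>, is
      what makes \<theta> positive.\<close>
    have "\<eta> * (4 * G^4 * M\<^sup>2 * (real T)\<^sup>2) < \<mu> * m * \<epsilon>^4"
      using \<eta> mM_pos G_pos T by (simp add: pos_less_divide_eq)
    then have *: "4 * \<eta> * (G / \<epsilon>)^4 * M\<^sup>2 * (real T)\<^sup>2 < \<mu> * m"
      using eps_pos by (simp add: field_simps power_divide)
    show ?thesis
    proof (rule geometric_bound[OF T windowed_lower_boundD[OF obs T] \<mu> _ * refl refl])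
      show "\<eta> < 8 / (m * \<mu>)" using \<eta> by simp
      show "\<theta> = \<mu> / 2 - 2 * \<eta> * (G / \<epsilon>) ^ 4 * M\<^sup>2 * (real T)\<^sup>2 / m"
        by (simp add: \<theta> power_divide mult.commute)
      show "\<zeta> = 2 * \<eta>\<^sup>2 * (G / \<epsilon>) ^ 4 * M ^ 4 * real T ^ 3 / m\<^sup>2"
        by (simp add: \<zeta> power_divide mult.commute)
      show "q = sqrt (1 - \<eta> * m / 4 * \<theta>)" by (rule q)
      show "A = 1 + \<eta> * (G / \<epsilon> * M) * sqrt (real T / \<alpha>0)"
        by (simp add: A \<alpha>0_def)
      show "L = A * sqrt ((\<eta> * m / 4 * \<zeta> + (\<alpha>0 + \<gamma>0) * real T) / (\<eta> * m / 4 * \<theta>))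
          + \<eta> * (G / \<epsilon> * M) * real T * sqrt (\<gamma>0 / \<alpha>0)"
        by (simp add: L \<alpha>0_def \<gamma>0_def)
    qed
  qed
  \<comment> \<open>Strictness of the gap makes the square positive, so the alternative hypothesis
    supplies an admissible \<mu>.\<close>
  have alt: "(sqrt lam / (\<epsilon> + G\<^sup>2) - G * inverse_variation B T)\<^sup>2 > 0 \<and>
      windowed_lower_bound \<psi> T ((sqrt lam / (\<epsilon> + G\<^sup>2) - G * inverse_variation B T)\<^sup>2)"
    if "lam > 0" "windowed_lower_bound g T lam" "G * inverse_variation B T < sqrt lam / (\<epsilon> + G\<^sup>2)" for lam
  proof -
    have "\<psi> = (\<lambda>t. matrix_inv (B t) *v g t)"
      by (simp add: fun_eq_iff \<psi>)
    then show ?thesis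
      using windowed_lower_bound_preconditioned[OF B_sym B_ge B_le eps_pos _ bounded_sensitivity that(2,1,3)]
        that(3) eps_pos by (simp add: add_pos_nonneg)
  qed
  show ?thesis
    unfolding Let_def
  proof ((rule conjI; intro allI impI), goal_cases)
    case (1 \<mu>)
    then have "\<mu> > 0" "windowed_lower_bound \<psi> T \<mu>"
      using alt by blast+
    \<comment> \<open>Either hypothesis has now been reduced to observability of \<psi>; the
      explicit constants also serve as witnesses for the existential claim.\<close>
    note explicit = bound[OF this conjunct2[OF 1] refl refl refl refl refl]
    show ?case
      by (rule conjI[OF _ explicit], rule exI, rule exI, rule exI, rule explicit)
  next
    case (2 lam)
    then show ?case
      using alt by blast
  qed
qed

end
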